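(* Let $d\ge 1$ and $n$ be integers with $d\le n-1$, let $\kappa>0$, let $a_1,\dots,a_n\in\mathcal H_d$ be points of hyperbolic $d$-space (hyperboloid model), and let $D=[d_{ij}]=[\mathrm d_H^\kappa(a_i,a_j)]\in\mathbb R_{\ge 0}^{n\times n}$ be the matrix of their hyperbolic distances with curvature $-\kappa$. Then $\texttt{hydra}(D,d,\kappa)$ recovers the points $a_1,\dots,a_n$ up to isometry: if $x_1,\dots,x_n$ are the rows of the matrix $X$ and $(r_1,u_1),\dots,(r_n,u_n)$ the radial/directional coordinates returned by $\texttt{hydra}(D,d,\kappa)$, then $x_1,\dots,x_n\in\mathcal H_d$ and there is an isometry $\varphi$ of $(\mathcal H_d,\mathrm d_H^\kappa)$ with $\varphi(a_i)=x_i$ for all $i$. In particular, $$\mathrm d_B^\kappa\big((r_i,u_i),(r_j,u_j)\big)=\mathrm d_H^\kappa(x_i,x_j)=d_{ij},\qquad i,j=1,\dots,n.$$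
   Context: Lorentz product on $\mathbb R^{d+1}$: $x\circ y:=x_1y_1-(x_2y_2+\dots+x_{d+1}y_{d+1})$. The space $\mathbb R^{d+1}$ with this product is denoted $\mathbb R^{1,d}$. The hyperboloid is $\mathcal H_d=\{x\in\mathbb R^{1,d}: x\circ x=1,\ x_1>0\}$, with the hyperbolic distance of curvature $-\kappa$ given by $\mathrm d_H^\kappa(x,y)=\frac1{\sqrt\kappa}\operatorname{arcosh}(x\circ y)$ for $x,y\in\mathcal H_d$. Poincaré ball: $\mathcal B_d=\{z\in\mathbb R^d:|z|<1\}$ (Euclidean norm). The stereographic projection $\xi(x)=\left(\frac{x_2}{1+x_1},\dots,\frac{x_{d+1}}{1+x_1}\right)$ restricts to a bijection $\mathcal H_d\to\mathcal B_d$, and $\mathrm d_B^\kappa$ is the distance on $\mathcal B_d$ defined by $\mathrm d_B^\kappa(\xi(x),\xi(y))=\mathrm d_H^\kappa(x,y)$ for $x,y\in\mathcal H_d$. A pair $(r,u)$ with $r\in[0,1)$ and $u\in\mathbb R^d$ a unit vector denotes the point $z=ru\in\mathcal B_d$ (for $r=0$ it is the origin, whatever $u$ is). The algorithm $\texttt{hydra}(D,d,\kappa)$. Input: a symmetric matrix $D=[d_{ij}]\in\mathbb R_{\ge0}^{n\times n}$ with zero diagonal, an embedding dimension $d\le n-1$, and $\kappa>0$. (A1) Set $A=[\cosh(\sqrt\kappa\,d_{ij})]$ and compute an eigendecomposition $A=Q\Lambda Q^\top$ with $Q$ orthogonal, $\Lambda=\operatorname{diag}(\lambda_1,\dots,\lambda_n)$,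 $\lambda_1\ge\dots\ge\lambda_n$, and columns $q_1,\dots,q_n$ of $Q$ the eigenvectors; $q_1$ is the Perron–Frobenius eigenvector of the entrywise positive matrix $A$, with its sign chosen so that $q_1$ is entrywise positive. (A2) Set $X=[x_{ij}]:=\left[\sqrt{\lambda_1}\,q_1\quad\sqrt{(-\lambda_{n-d+1})^+}\,q_{n-d+1}\quad\cdots\quad\sqrt{(-\lambda_n)^+}\,q_n\right]\in\mathbb R^{n\times(d+1)}$, where $x^+=\max(x,0)$. (B1) For $i=1,\dots,n$ set $u_i:=(x_{i2},\dots,x_{i(d+1)})/\sqrt{x_{i2}^2+\dots+x_{i(d+1)}^2}$ (if the denominator vanishes, $u_i$ is an arbitrary unit vector). (B2) Set $x_{\min}:=\min(1,x_{11},\dots,x_{n1})$ and $r_i:=\sqrt{\frac{x_{i1}-x_{\min}}{x_{i1}+x_{\min}}}$ for $i=1,\dots,n$. Output: the matrix $X$ and $(r_i,u_i)_{i=1,\dots,n}$. *)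

theory Defs
  imports Complex_Main "Jordan_Normal_Form.Matrix"
begin

text \<open>Vectors and matrices are indexed from 0. A point of \<open>\<real>\<^sup>1\<^sup>,\<^sup>d\<close> is a vector of dimension
  \<open>d + 1\<close> whose entry 0 is the time-like coordinate \<open>x\<^sub>1\<close>.\<close>

definition lorentz_prod :: "nat \<Rightarrow> real vec \<Rightarrow> real vec \<Rightarrow> real" where
  "lorentz_prod d x y = x $ 0 * y $ 0 - (\<Sum>i = 1..d. x $ i * y $ i)"

definition hyperboloid :: "nat \<Rightarrow> real vec set" where
  "hyperboloid d = {x \<in> carrier_vec (d + 1). lorentz_prod d x x = 1 \<and> x $ 0 > 0}"

definition hyp_dist :: "nat \<Rightarrow> real \<Rightarrow> real vec \<Rightarrow> real vec \<Rightarrow> real" where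
  "hyp_dist d \<kappa> x y = 1 / sqrt \<kappa> * arcosh (lorentz_prod d x y)"

definition hyp_isometry :: "nat \<Rightarrow> real \<Rightarrow> (real vec \<Rightarrow> real vec) \<Rightarrow> bool" where
  "hyp_isometry d \<kappa> \<phi> \<longleftrightarrow>
     bij_betw \<phi> (hyperboloid d) (hyperboloid d) \<and>
     (\<forall>x \<in> hyperboloid d. \<forall>y \<in> hyperboloid d. hyp_dist d \<kappa> (\<phi> x) (\<phi> y) = hyp_dist d \<kappa> x y)"

definition eucl_norm :: "real vec \<Rightarrow> real" where
  "eucl_norm z = sqrt (z \<bullet> z)"

definition unit_vectors :: "nat \<Rightarrow> real vec set" where
  "unit_vectors d = {u \<in> carrier_vec d. eucl_norm u = 1}"

definition poincare_ball :: "nat \<Rightarrow> real vec set" where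
  "poincare_ball d = {z \<in> carrier_vec d. eucl_norm z < 1}"

definition stereographic :: "nat \<Rightarrow> real vec \<Rightarrow> real vec" where
  "stereographic d x = vec d (\<lambda>k. x $ (k + 1) / (1 + x $ 0))"

text \<open>The ball distance is the transport of the hyperbolic distance along the bijection
  \<open>stereographic d\<close> from \<open>hyperboloid d\<close> to \<open>poincare_ball d\<close>; it is meaningful only for
  arguments in the ball.\<close>

definition ball_dist :: "nat \<Rightarrow> real \<Rightarrow> real vec \<Rightarrow> real vec \<Rightarrow> real" where
  "ball_dist d \<kappa> z w =
     hyp_dist d \<kappa> (inv_into (hyperboloid d) (stereographic d) z)
                  (inv_into (hyperboloid d) (stereographic d) w)"

text \<open>Step A1. The columns of \<open>Q\<close> are orthonormal eigenvectors for the eigenvalues \<open>l 0 \<ge> l 1 \<ge> \<dots>\<close>;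
  positivity of column 0 fixes the sign of the Perron--Frobenius eigenvector. The
  decomposition is not unique, so it is a relation.\<close>

definition hydra_eigendecomp :: "real mat \<Rightarrow> real \<Rightarrow> real mat \<Rightarrow> (nat \<Rightarrow> real) \<Rightarrow> bool" where
  "hydra_eigendecomp D \<kappa> Q l \<longleftrightarrow> (let n = dim_row D in
     Q \<in> carrier_mat n n \<and>
     transpose_mat Q * Q = 1\<^sub>m n \<and>
     map_mat (\<lambda>t. cosh (sqrt \<kappa> * t)) D = Q * mat_diag n l * transpose_mat Q \<and>
     (\<forall>i j. i \<le> j \<longrightarrow> j < n \<longrightarrow> l j \<le> l i) \<and>
     (\<forall>i<n. Q $$ (i, 0) > 0))"

text \<open>Step A2. Column \<open>j \<ge> 1\<close> belongs to the eigenvalue with 1-based number \<open>n - d + j\<close>,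
  that is, to the 0-based index \<open>n - d + j - 1\<close>.\<close>

definition hydra_coords :: "nat \<Rightarrow> nat \<Rightarrow> real mat \<Rightarrow> (nat \<Rightarrow> real) \<Rightarrow> real mat" where
  "hydra_coords n d Q l = mat n (d + 1) (\<lambda>(i, j).
     if j = 0 then sqrt (l 0) * Q $$ (i, 0)
     else sqrt (max (- l (n - d + j - 1)) 0) * Q $$ (i, n - d + j - 1))"

definition spatial_part :: "nat \<Rightarrow> real mat \<Rightarrow> nat \<Rightarrow> real vec" where
  "spatial_part d X i = vec d (\<lambda>k. X $$ (i, k + 1))"

definition hydra_xmin :: "real mat \<Rightarrow> real" where
  "hydra_xmin X = Min (insert 1 ((\<lambda>i. X $$ (i, 0)) ` {..<dim_row X}))"

text \<open>\<open>hydra D d \<kappa> X r u\<close> says that \<open>X\<close> and the pairs \<open>(r i, u i)\<close>, \<open>i < dim_row D\<close>, are a possible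
  output on input \<open>D\<close>, \<open>d\<close>, \<open>\<kappa>\<close>. It is a relation because of the choices of the
  eigendecomposition and of the direction of a point with vanishing spatial part.\<close>

definition hydra ::
  "real mat \<Rightarrow> nat \<Rightarrow> real \<Rightarrow> real mat \<Rightarrow> (nat \<Rightarrow> real) \<Rightarrow> (nat \<Rightarrow> real vec) \<Rightarrow> bool" where
  "hydra D d \<kappa> X r u \<longleftrightarrow> (let n = dim_row D in
     (\<exists>Q l. hydra_eigendecomp D \<kappa> Q l \<and> X = hydra_coords n d Q l) \<and>
     (\<forall>i<n.
        (let v = spatial_part d X i in
           if eucl_norm v = 0 then u i \<in> unit_vectors d
           else u i = (1 / eucl_norm v) \<cdot>\<^sub>v v) \<and>
        r i = sqrt ((X $$ (i, 0) - hydra_xmin X) / (X $$ (i, 0) + hydra_xmin X))))"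

end

(* With matching Gram matrices in hand, the isometry is a product of Lorentz reflections: if the
   first k points already agree, the reflection along the difference of the two candidates for the
   next point swaps these candidates and fixes all points at equal distance from both, hence
   the first k ones. The Gram matrices match because A has entries a_i o a_j, so by inertia it has
   exactly one positive and at most d negative eigenvalues. The eigenvalues dropped by hydra are
   therefore zero, and the retained columns reproduce A exactly. Since the rows of X
   lie on the hyperboloid, x_min = 1 and (r_i, u_i) are the polar coordinates of
   the stereographic projection. *)
theory Submission
  imports Defs "HOL-Analysis.Convex" "Jordan_Normal_Form.Determinant"
begin

subsection \<open>The Lorentz product\<close>

lemma lorentz_prod_commute: "lorentz_prod d x y = lorentz_prod d y x"
  by (simp add: lorentz_prod_def mult.commute)

lemma lorentz_prod_diff_left:
  assumes "x \<in> carrier_vec (d + 1)" "y \<in> carrier_vec (d + 1)"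
  shows "lorentz_prod d (x - y) z = lorentz_prod d x z - lorentz_prod d y z"
proof -
  have "(\<Sum>i = 1..d. (x - y) $ i * z $ i) = (\<Sum>i = 1..d. x $ i * z $ i - y $ i * z $ i)"
    using assms by (intro sum.cong) (auto simp: left_diff_distrib)
  then show ?thesis
    using assms by (simp add: lorentz_prod_def sum_subtractf left_diff_distrib)
qed

lemma lorentz_prod_smult_left:
  assumes "x \<in> carrier_vec (d + 1)"
  shows "lorentz_prod d (c \<cdot>\<^sub>v x) z = c * lorentz_prod d x z"
proof -
  have "(\<Sum>i = 1..d. (c \<cdot>\<^sub>v x) $ i * z $ i) = (\<Sum>i = 1..d. c * (x $ i * z $ i))"
    using assms by (intro sum.cong) auto
  then show ?thesis
    using assms by (simp add: lorentz_prod_def sum_distrib_left right_diff_distrib)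
qed

lemma lorentz_prod_diff_right:
  assumes "x \<in> carrier_vec (d + 1)" "y \<in> carrier_vec (d + 1)"
  shows "lorentz_prod d z (x - y) = lorentz_prod d z x - lorentz_prod d z y"
  using lorentz_prod_diff_left[OF assms] by (simp add: lorentz_prod_commute)

lemma lorentz_prod_smult_right:
  assumes "x \<in> carrier_vec (d + 1)"
  shows "lorentz_prod d z (c \<cdot>\<^sub>v x) = c * lorentz_prod d z x"
  using lorentz_prod_smult_left[OF assms] by (simp add: lorentz_prod_commute)

lemmas lorentz_prod_linear = lorentz_prod_diff_left lorentz_prod_diff_right
  lorentz_prod_smult_left lorentz_prod_smult_right

lemma lorentz_prod_lincomb_left:
  "lorentz_prod d (vec (d + 1) (\<lambda>m. \<Sum>k\<in>K. c k * w k $ m)) z = (\<Sum>k\<in>K. c k * lorentz_prod d (w k) z)"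
proof -
  have "(\<Sum>i = 1..d. vec (d + 1) (\<lambda>m. \<Sum>k\<in>K. c k * w k $ m) $ i * z $ i)
      = (\<Sum>i = 1..d. \<Sum>k\<in>K. c k * (w k $ i * z $ i))"
    by (intro sum.cong) (auto simp: sum_distrib_right mult.assoc)
  also have "\<dots> = (\<Sum>k\<in>K. \<Sum>i = 1..d. c k * (w k $ i * z $ i))"
    by (rule sum.swap)
  finally show ?thesis
    by (simp add: lorentz_prod_def sum_subtractf sum_distrib_left sum_distrib_right
        right_diff_distrib mult.assoc)
qed

text \<open>Bilinearity for combinations written out coordinatewise. It expresses the product of two
  combinations as a form in the Gram matrix, both for combinations with columns of \<open>Q\<close>
  as coefficients and in the inertia argument.\<close>

lemma lorentz_prod_lincomb:
  "lorentz_prod d (vec (d + 1) (\<lambda>m. \<Sum>k\<in>K. c k * w k $ m)) (vec (d + 1) (\<lambda>m. \<Sum>k\<in>L. e k * v k $ m))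
    = (\<Sum>k\<in>K. \<Sum>j\<in>L. c k * e j * lorentz_prod d (w k) (v j))"
  unfolding lorentz_prod_lincomb_left
  by (subst (1) lorentz_prod_commute, unfold lorentz_prod_lincomb_left)
    (simp add: sum_distrib_left mult.assoc lorentz_prod_commute)

lemma hyperboloidD:
  assumes "x \<in> hyperboloid d"
  shows "x \<in> carrier_vec (d + 1)" "lorentz_prod d x x = 1" "x $ 0 > 0"
    "(x $ 0)\<^sup>2 = 1 + (\<Sum>i = 1..d. (x $ i)\<^sup>2)" "x $ 0 \<ge> 1"
proof -
  show "x \<in> carrier_vec (d + 1)" "lorentz_prod d x x = 1" "x $ 0 > 0"
    using assms by (auto simp: hyperboloid_def)
  then show *: "(x $ 0)\<^sup>2 = 1 + (\<Sum>i = 1..d. (x $ i)\<^sup>2)"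
    by (simp add: lorentz_prod_def power2_eq_square)
  have "(x $ 0)\<^sup>2 \<ge> 1\<^sup>2"
    unfolding * by (simp add: sum_nonneg)
  then show "x $ 0 \<ge> 1"
    using \<open>x $ 0 > 0\<close> power2_le_imp_le less_imp_le by blast
qed

text \<open>Reversed Cauchy-Schwarz inequality, derived from the Euclidean one for the spatial
  parts. Keeping the squared distance \<open>\<delta>\<close> of the spatial parts in the estimate
  also settles the equality case.\<close>

lemma lorentz_prod_hyperboloid_ge_1:
  assumes x: "x \<in> hyperboloid d" and y: "y \<in> hyperboloid d"
  shows "lorentz_prod d x y \<ge> 1"
    and "lorentz_prod d x y = 1 \<Longrightarrow> x = y"
proof -
  define s p q where "s = (\<Sum>i = 1..d. x $ i * y $ i)"
    and "p = (\<Sum>i = 1..d. (x $ i)\<^sup>2)" and "q = (\<Sum>i = 1..d. (y $ i)\<^sup>2)"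
  define \<delta> where "\<delta> = (\<Sum>i = 1..d. (x $ i - y $ i)\<^sup>2)"
  note X = hyperboloidD[OF x, folded p_def] and Y = hyperboloidD[OF y, folded q_def]
  have "s\<^sup>2 \<le> p * q"
    unfolding s_def p_def q_def by (rule Cauchy_Schwarz_ineq_sum)
  moreover have "\<delta> = p + q - 2 * s"
    by (simp add: \<delta>_def s_def p_def q_def power2_diff sum.distrib sum_subtractf sum_distrib_left mult.assoc)
  \<comment> \<open>The right side is (1 + p)(1 + q) = 1 + p + q + pq. Since pq is at least the
    square of s, and p + q = \<open>\<delta>\<close> + 2s, the bound follows.\<close>
  ultimately have *: "(1 + s)\<^sup>2 + \<delta> \<le> (x $ 0 * y $ 0)\<^sup>2"
    by (simp add: power_mult_distrib X(4) Y(4)) (simp add: algebra_simps power2_eq_square)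
  have \<delta>: "\<delta> \<ge> 0"
    by (simp add: \<delta>_def sum_nonneg)
  have lp: "lorentz_prod d x y = x $ 0 * y $ 0 - s"
    by (simp add: lorentz_prod_def s_def)
  have "1 + s \<le> x $ 0 * y $ 0"
    using * \<delta> X(3) Y(3) by (intro power2_le_imp_le[of "1 + s"]) auto
  then show "lorentz_prod d x y \<ge> 1"
    by (simp add: lp)
  assume "lorentz_prod d x y = 1"
  then have "x $ 0 * y $ 0 = 1 + s"
    by (simp add: lp)
  with * \<delta> have "\<delta> = 0"
    by simp
  then have sp: "x $ i = y $ i" if "i \<in> {1..d}" for i
    using that by (auto simp: \<delta>_def sum_nonneg_eq_0_iff)
  then have "p = q"
    by (simp add: p_def q_def)
  then have "x $ 0 = y $ 0"
    using X(3,4) Y(3,4) power2_eq_imp_eq[of "x $ 0" "y $ 0"] by simp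
  with sp have "x $ i = y $ i" if "i < d + 1" for i
    using that by (cases i) auto
  then show "x = y"
    using X(1) Y(1) by (intro eq_vecI) auto
qed

text \<open>The curvature cancels and \<open>arcosh\<close> is undone on [1, \<infinity>). This is
  why the matrix of step A1 is the Lorentz Gram matrix of the given points.\<close>

lemma cosh_hyp_dist:
  assumes "\<kappa> > 0" "lorentz_prod d x y \<ge> 1"
  shows "cosh (sqrt \<kappa> * hyp_dist d \<kappa> x y) = lorentz_prod d x y"
  using assms by (simp add: hyp_dist_def)

subsection \<open>Reflections and congruent configurations\<close>

text \<open>For \<open>v\<close> of nonzero Lorentz square this negates \<open>v\<close> and fixes
  its Lorentz-orthogonal complement.\<close>

definition lorentz_reflection :: "nat \<Rightarrow> real vec \<Rightarrow> real vec \<Rightarrow> real vec" where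
  "lorentz_reflection d v y = y - (2 * lorentz_prod d y v / lorentz_prod d v v) \<cdot>\<^sub>v v"

lemma lorentz_prod_reflection:
  assumes "v \<in> carrier_vec (d + 1)" "lorentz_prod d v v \<noteq> 0"
    "y \<in> carrier_vec (d + 1)" "z \<in> carrier_vec (d + 1)"
  shows "lorentz_prod d (lorentz_reflection d v y) (lorentz_reflection d v z) = lorentz_prod d y z"
  using assms
  by (simp add: lorentz_reflection_def lorentz_prod_linear lorentz_prod_commute[of d v z])

lemma lorentz_reflection_involution:
  assumes "v \<in> carrier_vec (d + 1)" "lorentz_prod d v v \<noteq> 0" "y \<in> carrier_vec (d + 1)"
  shows "lorentz_reflection d v (lorentz_reflection d v y) = y"
proof -
  have "lorentz_prod d (lorentz_reflection d v y) v = - lorentz_prod d y v"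
    using assms by (simp add: lorentz_reflection_def lorentz_prod_linear)
  then show ?thesis
    using assms by (intro eq_vecI) (auto simp: lorentz_reflection_def)
qed

text \<open>For distinct points the map is the reflection along \<open>x - y\<close>. The last
  conclusion allows one more point to be moved into place without disturbing those already
  placed.\<close>

lemma hyp_isometry_swap:
  assumes x: "x \<in> hyperboloid d" and y: "y \<in> hyperboloid d"
  obtains \<phi> where "hyp_isometry d \<kappa> \<phi>" "\<phi> x = y"
    "\<And>z. z \<in> hyperboloid d \<Longrightarrow> lorentz_prod d z x = lorentz_prod d z y \<Longrightarrow> \<phi> z = z"
proof (cases "x = y")
  case True
  have "hyp_isometry d \<kappa> id"
    by (simp add: hyp_isometry_def)
  with True that show ?thesis by force
next
  case False
  define v where "v = x - y"
  let ?R = "lorentz_reflection d v"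
  note X = hyperboloidD[OF x] and Y = hyperboloidD[OF y]
  have v: "v \<in> carrier_vec (d + 1)"
    using X Y by (simp add: v_def)
  have vv: "lorentz_prod d v v = 2 - 2 * lorentz_prod d x y"
    using X Y by (simp add: v_def lorentz_prod_linear lorentz_prod_commute[of d y x])
  then have nz: "lorentz_prod d v v \<noteq> 0"
    using lorentz_prod_hyperboloid_ge_1[OF x y] False by auto
  \<comment> \<open>Hence the coefficient of \<open>v\<close> in the reflection of \<open>x\<close>
    is 1, and \<open>x\<close> goes to \<open>x - v = y\<close>.\<close>
  have "2 * lorentz_prod d x v = lorentz_prod d v v"
    using X Y by (simp add: vv) (simp add: v_def lorentz_prod_linear)
  then have Rx: "?R x = y"
    using X Y nz by (intro eq_vecI) (auto simp: lorentz_reflection_def v_def)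
  have "lorentz_prod d z v = 0" if "lorentz_prod d z x = lorentz_prod d z y" for z
    using that X Y by (simp add: v_def lorentz_prod_linear)
  then have fixed: "?R z = z" if "z \<in> hyperboloid d" "lorentz_prod d z x = lorentz_prod d z y" for z
    using that hyperboloidD(1)[OF that(1)] v by (intro eq_vecI) (auto simp: lorentz_reflection_def)
  have R_H: "?R z \<in> hyperboloid d" if z: "z \<in> hyperboloid d" for z
  proof -
    note Z = hyperboloidD[OF z]
    have carr: "?R z \<in> carrier_vec (d + 1)"
      using Z v by (simp add: lorentz_reflection_def)
    have one: "lorentz_prod d (?R z) (?R z) = 1"
      using lorentz_prod_reflection[OF v nz Z(1) Z(1)] Z by simp
    have "lorentz_prod d (?R z) y = lorentz_prod d z x"
      using lorentz_prod_reflection[OF v nz Z(1) X(1)] Rx by simp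
    then have ge: "lorentz_prod d (?R z) y \<ge> 1"
      using lorentz_prod_hyperboloid_ge_1(1)[OF z x] by simp
    \<comment> \<open>The reflection stays on the upper sheet: an image on the lower sheet would
      have its negative in the hyperboloid, so its product with \<open>y\<close> would be at most
      -1, whereas it equals the product of \<open>z\<close> and \<open>x\<close>, which is at least
      1.\<close>
    have "?R z $ 0 > 0"
    proof (rule ccontr)
      assume "\<not> ?R z $ 0 > 0"
      moreover have "?R z $ 0 \<noteq> 0"
      proof
        assume "?R z $ 0 = 0"
        then have "lorentz_prod d (?R z) (?R z) \<le> 0"
          by (simp add: lorentz_prod_def sum_nonneg)
        with one show False by simp
      qed
      ultimately have "- 1 \<cdot>\<^sub>v ?R z \<in> hyperboloid d"
        using carr one by (simp add: hyperboloid_def lorentz_prod_linear)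
      from lorentz_prod_hyperboloid_ge_1(1)[OF this y] ge show False
        using carr by (simp add: lorentz_prod_linear)
    qed
    with carr one show ?thesis
      by (simp add: hyperboloid_def)
  qed
  have "bij_betw ?R (hyperboloid d) (hyperboloid d)"
    using R_H by (intro bij_betw_byWitness[where f' = ?R])
      (auto simp: lorentz_reflection_involution[OF v nz hyperboloidD(1)])
  then have "hyp_isometry d \<kappa> ?R"
    using lorentz_prod_reflection[OF v nz] hyperboloidD(1) by (simp add: hyp_isometry_def hyp_dist_def)
  from that[OF this Rx fixed] show ?thesis .
qed

lemma hyp_isometry_lorentz_prod:
  assumes "\<kappa> > 0" "hyp_isometry d \<kappa> \<phi>" "x \<in> hyperboloid d" "y \<in> hyperboloid d"
  shows "\<phi> x \<in> hyperboloid d" "lorentz_prod d (\<phi> x) (\<phi> y) = lorentz_prod d x y"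
proof -
  have H: "\<phi> x \<in> hyperboloid d" "\<phi> y \<in> hyperboloid d"
    using assms by (auto simp: hyp_isometry_def dest: bij_betwE)
  show "\<phi> x \<in> hyperboloid d" by fact
  have "hyp_dist d \<kappa> (\<phi> x) (\<phi> y) = hyp_dist d \<kappa> x y"
    using assms by (simp add: hyp_isometry_def)
  then show "lorentz_prod d (\<phi> x) (\<phi> y) = lorentz_prod d x y"
    by (metis assms(1,3,4) H cosh_hyp_dist lorentz_prod_hyperboloid_ge_1(1))
qed

lemma hyp_isometry_comp:
  assumes "hyp_isometry d \<kappa> \<phi>" "hyp_isometry d \<kappa> \<psi>"
  shows "hyp_isometry d \<kappa> (\<psi> \<circ> \<phi>)"
  using assms bij_betw_trans[of \<phi> "hyperboloid d" "hyperboloid d" \<psi> "hyperboloid d"]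
  by (auto simp: hyp_isometry_def dest: bij_betwE)

lemma congruent_configurations:
  fixes a b :: "nat \<Rightarrow> real vec"
  assumes "\<kappa> > 0"
    and "\<forall>i<n. a i \<in> hyperboloid d" and "\<forall>i<n. b i \<in> hyperboloid d"
    and "\<forall>i<n. \<forall>j<n. lorentz_prod d (a i) (a j) = lorentz_prod d (b i) (b j)"
  shows "\<exists>\<phi>. hyp_isometry d \<kappa> \<phi> \<and> (\<forall>i<n. \<phi> (a i) = b i)"
  using assms(2-)
proof (induction n)
  case 0
  have "hyp_isometry d \<kappa> id"
    by (simp add: hyp_isometry_def)
  then show ?case by blast
next
  case (Suc n)
  then obtain \<phi> where \<phi>: "hyp_isometry d \<kappa> \<phi>" "\<forall>i<n. \<phi> (a i) = b i"
    by auto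
  have "\<phi> (a n) \<in> hyperboloid d" "b n \<in> hyperboloid d"
    using hyp_isometry_lorentz_prod(1)[OF \<open>\<kappa> > 0\<close> \<phi>(1)] Suc.prems by auto
  then obtain \<psi> where \<psi>: "hyp_isometry d \<kappa> \<psi>" "\<psi> (\<phi> (a n)) = b n"
    "\<And>z. z \<in> hyperboloid d \<Longrightarrow> lorentz_prod d z (\<phi> (a n)) = lorentz_prod d z (b n) \<Longrightarrow> \<psi> z = z"
    using hyp_isometry_swap by metis
  \<comment> \<open>\<open>b i\<close> has equal products with \<open>\<phi> (a n)\<close> and
    \<open>b n\<close>, because \<open>\<phi>\<close> preserves products, sends \<open>a i\<close>
    to \<open>b i\<close>, and the Gram matrices agree.\<close>
  have "\<psi> (b i) = b i" if "i < n" for i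
  proof (rule \<psi>(3))
    show "b i \<in> hyperboloid d"
      using Suc.prems that by simp
    have "lorentz_prod d (\<phi> (a i)) (\<phi> (a n)) = lorentz_prod d (b i) (b n)"
      using hyp_isometry_lorentz_prod(2)[OF \<open>\<kappa> > 0\<close> \<phi>(1)] Suc.prems that by simp
    then show "lorentz_prod d (b i) (\<phi> (a n)) = lorentz_prod d (b i) (b n)"
      using \<phi>(2) that by simp
  qed
  then have "\<forall>i<Suc n. (\<psi> \<circ> \<phi>) (a i) = b i"
    using \<phi>(2) \<psi>(2) by (auto simp: less_Suc_eq)
  with hyp_isometry_comp[OF \<phi>(1) \<psi>(1)] show ?case
    by blast
qed

subsection \<open>Stereographic projection\<close>

lemma sum_spatial_squares:
  assumes "x \<in> hyperboloid d"
  shows "(\<Sum>i = 1..d. (x $ i)\<^sup>2) = (x $ 0 - 1) * (x $ 0 + 1)"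
  using hyperboloidD(4)[OF assms] by (simp add: algebra_simps power2_eq_square)

text \<open>The squared norm of the image is (t - 1)/(t + 1) with t the time coordinate. This is
  injective for t > 0, so the image determines t and then, after multiplication by 1 + t, the
  spatial coordinates.\<close>

lemma inj_on_stereographic: "inj_on (stereographic d) (hyperboloid d)"
proof (rule inj_onI)
  fix x y
  assume x: "x \<in> hyperboloid d" and y: "y \<in> hyperboloid d"
    and eq: "stereographic d x = stereographic d y"
  note X = hyperboloidD[OF x] and Y = hyperboloidD[OF y]
  have comp: "x $ i / (1 + x $ 0) = y $ i / (1 + y $ 0)" if "i \<in> {1..d}" for i
  proof -
    have "stereographic d z $ (i - 1) = z $ i / (1 + z $ 0)" for z
      using that unfolding stereographic_def by (subst index_vec) auto
    with eq show ?thesis by metis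
  qed
  have sq: "(\<Sum>i = 1..d. (z $ i / (1 + z $ 0))\<^sup>2) = (z $ 0 - 1) / (z $ 0 + 1)"
    if "z \<in> hyperboloid d" for z
  proof -
    have "(\<Sum>i = 1..d. (z $ i / (1 + z $ 0))\<^sup>2) = (\<Sum>i = 1..d. (z $ i)\<^sup>2) / (1 + z $ 0)\<^sup>2"
      by (simp add: power_divide sum_divide_distrib)
    then show ?thesis
      using hyperboloidD(3)[OF that] sum_spatial_squares[OF that]
      by (simp add: power2_eq_square add.commute)
  qed
  have "(x $ 0 - 1) / (x $ 0 + 1) = (y $ 0 - 1) / (y $ 0 + 1)"
    using sum.cong[OF refl, of "{1..d}" "\<lambda>i. (x $ i / (1 + x $ 0))\<^sup>2" "\<lambda>i. (y $ i / (1 + y $ 0))\<^sup>2"]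
      comp sq[OF x] sq[OF y] by simp
  then have zero: "x $ 0 = y $ 0"
    using X(3) Y(3) by (simp add: field_simps)
  have "x $ i = y $ i" if "i < d + 1" for i
    using that zero comp[of i] X(3) by (cases "i = 0") auto
  then show "x = y"
    using X(1) Y(1) by (intro eq_vecI) auto
qed

text \<open>The spatial part has norm sqrt(t - 1) sqrt(t + 1), with t the time coordinate. Dividing
  the radius of step B2 for \<open>x_min = 1\<close> by it leaves 1/(1 + t), the factor of the
  stereographic projection.\<close>

lemma stereographic_polar:
  assumes x: "x \<in> hyperboloid d" and v: "v = vec d (\<lambda>k. x $ (k + 1))"
    and u: "if eucl_norm v = 0 then u \<in> unit_vectors d else u = (1 / eucl_norm v) \<cdot>\<^sub>v v"
  shows "u \<in> unit_vectors d"
    and "sqrt ((x $ 0 - 1) / (x $ 0 + 1)) \<cdot>\<^sub>v u = stereographic d x"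
proof -
  note X = hyperboloidD[OF x]
  have "v \<bullet> v = (\<Sum>i = 0..<d. (x $ (Suc i))\<^sup>2)"
    by (simp add: v scalar_prod_def power2_eq_square)
  also have "\<dots> = (\<Sum>i = 1..d. (x $ i)\<^sup>2)"
    using sum.shift_bounds_Suc_ivl[of "\<lambda>i. (x $ i)\<^sup>2" 0 d]
    by (simp add: atLeastLessThanSuc_atLeastAtMost)
  finally have vv: "v \<bullet> v = (x $ 0 - 1) * (x $ 0 + 1)"
    using sum_spatial_squares[OF x] by simp
  have norm: "eucl_norm v = sqrt (x $ 0 - 1) * sqrt (x $ 0 + 1)"
    by (simp add: eucl_norm_def vv real_sqrt_mult)
  have carr: "v \<in> carrier_vec d"
    by (simp add: v)
  show U: "u \<in> unit_vectors d"
  proof (cases "eucl_norm v = 0")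
    case False
    have "((1 / eucl_norm v) \<cdot>\<^sub>v v) \<bullet> ((1 / eucl_norm v) \<cdot>\<^sub>v v) = (1 / eucl_norm v)\<^sup>2 * (v \<bullet> v)"
      using carr by (simp add: power2_eq_square)
    also have "v \<bullet> v = (eucl_norm v)\<^sup>2"
      using X(5) by (simp add: eucl_norm_def vv)
    finally show ?thesis
      using False u carr by (simp add: unit_vectors_def eucl_norm_def power_divide)
  qed (use u in simp)
  then have "u \<in> carrier_vec d"
    by (simp add: unit_vectors_def)
  show "sqrt ((x $ 0 - 1) / (x $ 0 + 1)) \<cdot>\<^sub>v u = stereographic d x"
  proof (cases "eucl_norm v = 0")
    \<comment> \<open>Vanishing spatial part: the time coordinate is 1, so the radius is 0 and both
      sides are the origin, whatever direction \<open>u\<close> was chosen.\<close>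
    case True
    then have "x $ 0 = 1"
      using X(5) by (simp add: norm)
    then have "\<forall>i\<in>{1..d}. x $ i = 0"
      using sum_spatial_squares[OF x] by (simp add: sum_nonneg_eq_0_iff)
    then show ?thesis
      using \<open>x $ 0 = 1\<close> \<open>u \<in> carrier_vec d\<close> by (intro eq_vecI) (auto simp: stereographic_def)
  next
    case False
    then have "x $ 0 > 1"
      using X(5) by (cases "x $ 0 = 1") (auto simp: norm)
    then have "sqrt ((x $ 0 - 1) / (x $ 0 + 1)) * (1 / eucl_norm v) = 1 / (sqrt (x $ 0 + 1) * sqrt (x $ 0 + 1))"
      by (simp add: norm real_sqrt_divide)
    also have "\<dots> = 1 / (1 + x $ 0)"
      using X(3) by (simp add: add.commute)
    finally have "sqrt ((x $ 0 - 1) / (x $ 0 + 1)) * (1 / eucl_norm v) = 1 / (1 + x $ 0)" .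
    then have "sqrt ((x $ 0 - 1) / (x $ 0 + 1)) \<cdot>\<^sub>v u = (1 / (1 + x $ 0)) \<cdot>\<^sub>v v"
      using False u by (simp add: smult_smult_assoc)
    also have "\<dots> = stereographic d x"
      by (intro eq_vecI) (auto simp: v stereographic_def)
    finally show ?thesis .
  qed
qed

subsection \<open>The spectrum of a Lorentzian Gram matrix\<close>

text \<open>Here \<open>d\<close> homogeneous equations meet \<open>d + 1\<close> unknowns. A zero
  row in position 0 pads the system to a singular square matrix, and the equations keep the numbers
  1 to \<open>d\<close> of the spatial coordinates.\<close>

lemma underdetermined_system:
  fixes f :: "nat \<Rightarrow> nat \<Rightarrow> 'a :: field"
  obtains c where "\<exists>j\<le>d. c j \<noteq> 0" "\<And>i. i \<in> {1..d} \<Longrightarrow> (\<Sum>j\<le>d. c j * f i j) = 0"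
proof -
  define A where "A = mat (Suc d) (Suc d) (\<lambda>(i, j). if i = 0 then 0 else f i j)"
  have A: "A \<in> carrier_mat (Suc d) (Suc d)"
    by (simp add: A_def)
  have "A = mat\<^sub>r (Suc d) (Suc d) (\<lambda>i. if i = 0 then 0\<^sub>v (Suc d) else vec (Suc d) (f i))"
    by (intro eq_matI) (auto simp: A_def)
  then have "det A = 0"
    by (simp add: det_row_0)
  then obtain v where v: "v \<in> carrier_vec (Suc d)" "v \<noteq> 0\<^sub>v (Suc d)" "A *\<^sub>v v = 0\<^sub>v (Suc d)"
    using det_0_iff_vec_prod_zero_field[OF A] by auto
  show ?thesis
  proof (rule that[of "\<lambda>j. v $ j"])
    show "\<exists>j\<le>d. v $ j \<noteq> 0"
    proof (rule ccontr)
      assume "\<not> ?thesis"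
      then have "v = 0\<^sub>v (Suc d)"
        using v(1) by (intro eq_vecI) auto
      with v(2) show False by simp
    qed
    fix i assume "i \<in> {1..d}"
    then have "(A *\<^sub>v v) $ i = (\<Sum>j = 0..<Suc d. f i j * v $ j)"
      using v(1) by (auto simp: A_def scalar_prod_def intro!: sum.cong)
    then show "(\<Sum>j\<le>d. v $ j * f i j) = 0"
      using \<open>i \<in> {1..d}\<close> v(3) by (simp add: atLeast0LessThan lessThan_Suc_atMost mult.commute)
  qed
qed

text \<open>Sylvester's law of inertia for the signature \<open>(1, d)\<close>: two orthogonal time-like vectors have
  a combination without time component, and \<open>d + 1\<close> orthogonal space-like vectors
  have one without spatial components.\<close>

lemma lorentz_orthogonal_signature:
  fixes w :: "nat \<Rightarrow> real vec" and l :: "nat \<Rightarrow> real"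
  assumes orth: "\<And>k m. k < n \<Longrightarrow> m < n \<Longrightarrow> lorentz_prod d (w k) (w m) = (if k = m then l k else 0)"
    and desc: "\<And>i j. i \<le> j \<Longrightarrow> j < n \<Longrightarrow> l j \<le> l i"
    and pos: "l 0 > 0" and k: "k < n"
  shows "0 < k \<Longrightarrow> l k \<le> 0" and "k < n - d \<Longrightarrow> 0 \<le> l k"
proof -
  assume "0 < k"
  show "l k \<le> 0"
  proof (rule ccontr)
    assume "\<not> l k \<le> 0"
    have "lorentz_prod d (w 0) (w 0) > 0"
      using orth[of 0 0] k pos by simp
    \<comment> \<open>Without a time component the Lorentz square could not be positive.\<close>
    then have nz: "w 0 $ 0 \<noteq> 0"
      using sum_nonneg[of "{1..d}" "\<lambda>i. w 0 $ i * w 0 $ i"] by (auto simp: lorentz_prod_def)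
    \<comment> \<open>The coefficients make the time components of \<open>w 0\<close> and
      \<open>w k\<close> cancel, while orthogonality makes the Lorentz square of the combination
      positive.\<close>
    define c where "c i = (if i = 0 then w k $ 0 else - w 0 $ 0)" for i :: nat
    define y where "y = vec (d + 1) (\<lambda>m. \<Sum>i\<in>{0, k}. c i * w i $ m)"
    have "y $ 0 = 0"
      using \<open>0 < k\<close> by (simp add: y_def c_def)
    then have "lorentz_prod d y y \<le> 0"
      by (simp add: lorentz_prod_def sum_nonneg)
    moreover have "lorentz_prod d y y = (w k $ 0)\<^sup>2 * l 0 + (w 0 $ 0)\<^sup>2 * l k"
      unfolding y_def lorentz_prod_lincomb
      using \<open>0 < k\<close> k by (simp add: orth c_def power2_eq_square)
    moreover have "(w 0 $ 0)\<^sup>2 * l k > 0" "(w k $ 0)\<^sup>2 * l 0 \<ge> 0"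
      using nz pos \<open>\<not> l k \<le> 0\<close> by auto
    ultimately show False by linarith
  qed
next
  assume kd: "k < n - d"
  show "0 \<le> l k"
  proof (rule ccontr)
    assume "\<not> 0 \<le> l k"
    \<comment> \<open>From \<open>k < n - d\<close> the indices \<open>k, ..., k + d\<close> all lie
      below \<open>n\<close>; by the ordering of the eigenvalues this gives \<open>d + 1\<close>
      orthogonal vectors of negative square.\<close>
    then have neg: "l (k + j) < 0" if "j \<le> d" for j
      using desc[of k "k + j"] kd that \<open>\<not> 0 \<le> l k\<close> by linarith
    obtain c :: "nat \<Rightarrow> real" where c: "\<exists>j\<le>d. c j \<noteq> 0"
      "\<And>i. i \<in> {1..d} \<Longrightarrow> (\<Sum>j\<le>d. c j * w (k + j) $ i) = 0"
      using underdetermined_system[where f = "\<lambda>i j. w (k + j) $ i"] by metis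
    define y where "y = vec (d + 1) (\<lambda>m. \<Sum>j\<le>d. c j * w (k + j) $ m)"
    \<comment> \<open>All spatial components of \<open>y\<close> vanish by the choice of
      \<open>c\<close>, so its Lorentz square is nonnegative; the eigenvalues will show that it is
      negative.\<close>
    have "lorentz_prod d y y = (y $ 0)\<^sup>2"
      using c(2) by (simp add: lorentz_prod_def y_def power2_eq_square)
    moreover have "lorentz_prod d y y = (\<Sum>i\<le>d. \<Sum>j\<le>d. if i = j then (c i)\<^sup>2 * l (k + i) else 0)"
      unfolding y_def lorentz_prod_lincomb using kd
      by (intro sum.cong refl) (auto simp: orth power2_eq_square)
    moreover have "\<dots> = (\<Sum>i\<le>d. (c i)\<^sup>2 * l (k + i))"
      by simp
    moreover have "(\<Sum>i\<le>d. (c i)\<^sup>2 * l (k + i)) < (\<Sum>i\<le>d. 0)"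
    proof (rule sum_strict_mono_ex1)
      show "\<forall>i\<in>{..d}. (c i)\<^sup>2 * l (k + i) \<le> 0"
        using neg by (simp add: mult_nonneg_nonpos less_imp_le)
      obtain j where "j \<le> d" "c j \<noteq> 0"
        using c(1) by blast
      then have "(c j)\<^sup>2 * l (k + j) < 0"
        using neg[of j] by (intro mult_pos_neg) auto
      with \<open>j \<le> d\<close> show "\<exists>i\<in>{..d}. (c i)\<^sup>2 * l (k + i) < 0"
        by blast
    qed simp
    ultimately show False
      using zero_le_power2[of "y $ 0"] by simp
  qed
qed

text \<open>The entries of \<open>transpose_mat Q * A * Q\<close>, expanded into the double sum that
  \<open>lorentz_prod_lincomb\<close> produces.\<close>

lemma congruence_diagonal:
  fixes Q A :: "'a :: comm_ring_1 mat"
  assumes Q: "Q \<in> carrier_mat n n" "transpose_mat Q * Q = 1\<^sub>m n"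
    and A: "A = Q * mat_diag n l * transpose_mat Q" and km: "k < n" "m < n"
  shows "(\<Sum>i = 0..<n. \<Sum>j = 0..<n. Q $$ (i, k) * Q $$ (j, m) * A $$ (i, j)) = (if k = m then l k else 0)"
proof -
  let ?T = "transpose_mat Q"
  have T: "?T \<in> carrier_mat n n" and L: "mat_diag n l \<in> carrier_mat n n"
    using Q by auto
  have carr: "A \<in> carrier_mat n n"
    unfolding A using Q T L by auto
  have "A * Q = Q * mat_diag n l * (?T * Q)"
    unfolding A using Q T L by (intro assoc_mult_mat[of _ n n _ n _ n]) auto
  then have "?T * (A * Q) = ?T * (Q * mat_diag n l)"
    using Q L by (simp add: right_mult_one_mat[of _ n n])
  also have "\<dots> = (?T * Q) * mat_diag n l"
    using Q T L by (intro assoc_mult_mat[symmetric, of _ n n _ n _ n]) auto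
  finally have "?T * (A * Q) = mat_diag n l"
    using Q L by simp
  moreover have "(?T * (A * Q)) $$ (k, m)
      = (\<Sum>i = 0..<n. Q $$ (i, k) * (\<Sum>j = 0..<n. A $$ (i, j) * Q $$ (j, m)))"
    using Q carr km by (simp add: scalar_prod_def)
  ultimately show ?thesis
    using km by (simp add: mat_diag_def sum_distrib_left mult_ac cong: if_cong split: if_splits)
qed

lemma diagonalization_entry:
  fixes Q A :: "'a :: comm_ring_1 mat"
  assumes "Q \<in> carrier_mat n n" "A = Q * mat_diag n l * transpose_mat Q" "i < n" "j < n"
  shows "A $$ (i, j) = (\<Sum>k = 0..<n. l k * Q $$ (i, k) * Q $$ (j, k))"
  using assms by (simp add: mat_diag_mult_right scalar_prod_def ac_simps)

text \<open>In the spectral sum of \<open>A\<close>, index 0 gives the time product and the last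
  \<open>d\<close> indices give minus the spatial products. The indices in between have eigenvalues
  of both weak signs, hence zero.\<close>

lemma hydra_coords_gram:
  assumes Q: "Q \<in> carrier_mat n n" "A = Q * mat_diag n l * transpose_mat Q"
    and d: "d < n" and l: "l 0 \<ge> 0" "\<And>k. 0 < k \<Longrightarrow> k < n \<Longrightarrow> l k \<le> 0"
      "\<And>k. k < n - d \<Longrightarrow> 0 \<le> l k"
    and ij: "i < n" "j < n"
  defines "X \<equiv> hydra_coords n d Q l"
  shows "lorentz_prod d (row X i) (row X j) = A $$ (i, j)"
proof -
  define g where "g k = l k * Q $$ (i, k) * Q $$ (j, k)" for k
  have "row X i $ 0 * row X j $ 0 = (sqrt (l 0))\<^sup>2 * (Q $$ (i, 0) * Q $$ (j, 0))"
    using ij by (simp add: X_def hydra_coords_def power2_eq_square)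
  then have time: "row X i $ 0 * row X j $ 0 = g 0"
    using l(1) by (simp add: g_def)
  have "row X i $ m * row X j $ m = - g (n - d + m - 1)" if "m \<in> {1..d}" for m
  proof -
    let ?k = "n - d + m - 1"
    \<comment> \<open>Because \<open>d < n\<close>, no spatial column reuses the leading index 0.
      Its eigenvalue is therefore nonpositive, and the positive part in step A2 truncates
      nothing.\<close>
    have "0 < ?k" "?k < n"
      using that d by auto
    then have "max (- l ?k) 0 = - l ?k"
      using l(2)[of ?k] by simp
    moreover have "row X i $ m * row X j $ m = (sqrt (max (- l ?k) 0))\<^sup>2 * (Q $$ (i, ?k) * Q $$ (j, ?k))"
      using that ij by (simp add: X_def hydra_coords_def power2_eq_square)
    ultimately show ?thesis
      by (simp add: g_def)
  qed
  then have "(\<Sum>m = 1..d. row X i $ m * row X j $ m) = (\<Sum>m = 1..d. - g (n - d + m - 1))"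
    by (rule sum.cong[OF refl])
  also have "\<dots> = (\<Sum>k = n - d..<n. - g k)"
    using d by (intro sum.reindex_bij_witness[of _ "\<lambda>k. k + 1 - (n - d)" "\<lambda>m. n - d + m - 1"]) auto
  finally have space: "(\<Sum>m = 1..d. row X i $ m * row X j $ m) = - (\<Sum>k = n - d..<n. g k)"
    by (simp add: sum_negf)
  have "(\<Sum>k = 1..<n - d. g k) = 0"
  proof (rule sum.neutral, rule ballI)
    fix k assume "k \<in> {1..<n - d}"
    then have "l k = 0"
      using l(2)[of k] l(3)[of k] by (intro order_antisym) auto
    then show "g k = 0"
      by (simp add: g_def)
  qed
  moreover have "(\<Sum>k = 0..<n - d. g k) = g 0 + (\<Sum>k = 1..<n - d. g k)"
    using d by (simp add: sum.atLeast_Suc_lessThan)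
  moreover have "(\<Sum>k = 0..<n. g k) = (\<Sum>k = 0..<n - d. g k) + (\<Sum>k = n - d..<n. g k)"
    by (simp add: sum.atLeastLessThan_concat)
  moreover have "A $$ (i, j) = (\<Sum>k = 0..<n. g k)"
    unfolding g_def by (rule diagonalization_entry[OF Q ij])
  ultimately show ?thesis
    by (simp add: lorentz_prod_def time space del: index_row One_nat_def)
qed

subsection \<open>Exact recovery\<close>

lemma hydra_coords_hyperboloid_gram:
  assumes "d < n" and "\<kappa> > 0" and a: "\<forall>i<n. a i \<in> hyperboloid d"
    and D: "D = mat n n (\<lambda>(i, j). hyp_dist d \<kappa> (a i) (a j))"
    and eig: "hydra_eigendecomp D \<kappa> Q l"
  defines "X \<equiv> hydra_coords n d Q l"
  shows "i < n \<Longrightarrow> row X i \<in> hyperboloid d"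
    and "i < n \<Longrightarrow> j < n \<Longrightarrow> lorentz_prod d (row X i) (row X j) = lorentz_prod d (a i) (a j)"
proof -
  define A where "A = map_mat (\<lambda>t. cosh (sqrt \<kappa> * t)) D"
  have Q: "Q \<in> carrier_mat n n" "transpose_mat Q * Q = 1\<^sub>m n"
      "A = Q * mat_diag n l * transpose_mat Q"
    and desc: "\<And>i j. i \<le> j \<Longrightarrow> j < n \<Longrightarrow> l j \<le> l i" and Q0: "\<And>i. i < n \<Longrightarrow> Q $$ (i, 0) > 0"
    using eig by (auto simp: hydra_eigendecomp_def Let_def A_def D)
  have A: "A $$ (i, j) = lorentz_prod d (a i) (a j)" if "i < n" "j < n" for i j
    using that a \<open>\<kappa> > 0\<close> by (simp add: A_def D cosh_hyp_dist lorentz_prod_hyperboloid_ge_1)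
  \<comment> \<open>Combining the points with the entries of column \<open>k\<close> of
    \<open>Q\<close> gives vectors with diagonal Gram matrix, to which the inertia argument
    applies.\<close>
  define w where "w k = vec (d + 1) (\<lambda>m. \<Sum>i = 0..<n. Q $$ (i, k) * a i $ m)" for k
  have orth: "lorentz_prod d (w k) (w m) = (if k = m then l k else 0)" if "k < n" "m < n" for k m
    unfolding w_def lorentz_prod_lincomb congruence_diagonal[OF Q that, symmetric]
    by (intro sum.cong refl) (simp add: A)
  \<comment> \<open>Otherwise all eigenvalues are nonpositive and so is every diagonal entry of
    \<open>A\<close>, but \<open>A $$ (0, 0)\<close> is the Lorentz square of \<open>a 0\<close>,
    which is 1.\<close>
  have "l 0 > 0"
  proof (rule ccontr)
    assume "\<not> l 0 > 0"
    then have neg: "l k \<le> 0" if "k < n" for k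
      using desc[of 0 k] that by simp
    have "A $$ (0, 0) = 1"
      using A[of 0 0] a \<open>d < n\<close> by (simp add: hyperboloidD(2))
    moreover have "A $$ (0, 0) \<le> 0"
      using \<open>d < n\<close> neg
      by (subst diagonalization_entry[OF Q(1,3)])
        (auto simp: mult.assoc intro!: sum_nonpos mult_nonpos_nonneg)
    ultimately show False by simp
  qed
  note sig = lorentz_orthogonal_signature[OF orth desc this]
  have gram: "lorentz_prod d (row X i) (row X j) = A $$ (i, j)" if "i < n" "j < n" for i j
    unfolding X_def using \<open>d < n\<close> \<open>l 0 > 0\<close> that
    by (intro hydra_coords_gram[OF Q(1,3)]) (auto intro: sig)
  show "lorentz_prod d (row X i) (row X j) = lorentz_prod d (a i) (a j)" if "i < n" "j < n"
    using gram A that by simp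
  show "row X i \<in> hyperboloid d" if "i < n"
  proof -
    \<comment> \<open>The sign convention for the Perron-Frobenius eigenvector places the rows on
      the upper sheet.\<close>
    have "row X i $ 0 > 0"
      using that Q0 \<open>l 0 > 0\<close> by (simp add: X_def hydra_coords_def)
    moreover have "row X i \<in> carrier_vec (d + 1)"
      using that by (simp add: X_def hydra_coords_def)
    moreover have "lorentz_prod d (row X i) (row X i) = 1"
      using gram[OF that that] A[OF that that] hyperboloidD(2)[of "a i" d] a that by metis
    ultimately show ?thesis
      by (simp add: hyperboloid_def)
  qed
qed

theorem theorem3p1:
  fixes d n :: nat and \<kappa> :: real
    and a :: "nat \<Rightarrow> real vec" and D X :: "real mat"
    and r :: "nat \<Rightarrow> real" and u :: "nat \<Rightarrow> real vec"
  assumes "d \<ge> 1" and "d \<le> n - 1" and "\<kappa> > 0"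
    and "\<forall>i<n. a i \<in> hyperboloid d"
    and "D = mat n n (\<lambda>(i, j). hyp_dist d \<kappa> (a i) (a j))"
    and "hydra D d \<kappa> X r u"
  shows "(\<forall>i<n. row X i \<in> hyperboloid d) \<and>
    (\<exists>\<phi>. hyp_isometry d \<kappa> \<phi> \<and> (\<forall>i<n. \<phi> (a i) = row X i)) \<and>
    (\<forall>i<n. r i \<in> {0..<1} \<and> u i \<in> unit_vectors d) \<and>
    (\<forall>i<n. \<forall>j<n.
       ball_dist d \<kappa> (r i \<cdot>\<^sub>v u i) (r j \<cdot>\<^sub>v u j) = hyp_dist d \<kappa> (row X i) (row X j) \<and>
       hyp_dist d \<kappa> (row X i) (row X j) = D $$ (i, j))"
proof -
  have dn: "d < n" using assms(1,2) by simp
  obtain Q l where eig: "hydra_eigendecomp D \<kappa> Q l" and "X = hydra_coords (dim_row D) d Q l"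
    using assms(6) by (auto simp: hydra_def Let_def)
  then have X: "X = hydra_coords n d Q l"
    by (simp add: assms(5))
  note rec = hydra_coords_hyperboloid_gram[OF dn assms(3-5) eig, folded X]
  have dimX: "dim_row X = n" "dim_col X = d + 1"
    by (simp_all add: X hydra_coords_def)
  have "X $$ (i, 0) \<ge> 1" if "i < n" for i
    using hyperboloidD(5)[OF rec(1)[OF that]] that by (simp add: dimX)
  \<comment> \<open>The inserted 1 is the minimum, since every row of \<open>X\<close> has time
    coordinate at least 1.\<close>
  then have xmin: "hydra_xmin X = 1"
    unfolding hydra_xmin_def by (intro Min_eqI) (auto simp: dimX)
  have polar: "u i \<in> unit_vectors d" "r i \<cdot>\<^sub>v u i = stereographic d (row X i)" "r i \<in> {0..<1}"
    if i: "i < n" for i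
  proof -
    note H = rec(1)[OF i]
    have sp: "spatial_part d X i = vec d (\<lambda>k. row X i $ (k + 1))"
      using i by (intro eq_vecI) (auto simp: spatial_part_def dimX)
    have u: "if eucl_norm (spatial_part d X i) = 0 then u i \<in> unit_vectors d
        else u i = (1 / eucl_norm (spatial_part d X i)) \<cdot>\<^sub>v spatial_part d X i"
      and "r i = sqrt ((X $$ (i, 0) - 1) / (X $$ (i, 0) + 1))"
      using assms(5,6) i xmin by (simp_all add: hydra_def Let_def)
    then have r: "r i = sqrt ((row X i $ 0 - 1) / (row X i $ 0 + 1))"
      using i by (simp add: dimX)
    show "u i \<in> unit_vectors d" "r i \<cdot>\<^sub>v u i = stereographic d (row X i)"
      using stereographic_polar[OF H sp u] by (simp_all only: r)
    show "r i \<in> {0..<1}"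
      unfolding r using hyperboloidD(5)[OF H] by (auto simp: divide_simps)
  qed
  \<comment> \<open>The polar coordinates give the projection of a known hyperboloid point, so
    injectivity identifies the preimage used in \<open>ball_dist\<close>.\<close>
  have inv: "inv_into (hyperboloid d) (stereographic d) (r i \<cdot>\<^sub>v u i) = row X i" if "i < n" for i
    unfolding polar(2)[OF that] by (rule inv_into_f_f[OF inj_on_stereographic rec(1)[OF that]])
  have "\<exists>\<phi>. hyp_isometry d \<kappa> \<phi> \<and> (\<forall>i<n. \<phi> (a i) = row X i)"
    using assms(3,4) rec by (intro congruent_configurations) auto
  moreover have "hyp_dist d \<kappa> (row X i) (row X j) = D $$ (i, j)" if "i < n" "j < n" for i j
    using that rec(2)[OF that] by (simp add: assms(5) hyp_dist_def)
  ultimately show ?thesis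
    using rec(1) polar inv by (auto simp: ball_dist_def)
qed

end
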